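(* Let $m\ge1$, $d\ge0$, let $\lambda=e^{2\pi i\alpha}$ with $\alpha\in\mathbb R\setminus\mathbb Q$, and for each $i\in\mathbb N^m$ with $0\le|i|=i_1+\dots+i_m\le d$ let $f_i:\mathbb C\to\mathbb C$ be an entire function with $f_i(z)=O(z^2)$ at $0$. For $t\in\mathbb C^m$ consider the entire function $$f_t(z)=\lambda z+\sum_{i\in\mathbb N^m,\ 0\le|i|\le d}t^if_i(z),$$ so that $f_t(0)=0$ and $f_t'(0)=\lambda$. Then either $f_t$ is linearizable at $0$ for all $t\in\mathbb C^m$, or there is an exceptional set $E\subset\mathbb C^m$ of $\Gamma$-capacity $0$ such that $f_t$ is not linearizable at $0$ for every $t\in\mathbb C^m\setminus E$.
   Context: $f_t$ is linearizable at $0$ if there is a germ of holomorphic diffeomorphism $h$ of $(\mathbb C,0)$ with $h(0)=0$, $h'(0)=1$ and $h\circ f_t=\lambda h$ near $0$. $\Gamma$-capacity: for $E\subset\mathbb C$, $\mathrm{Cap}(E)$ is the logarithmic capacity, $\mathrm{Cap}(E)=\sup_\mu e^{I(\mu)}$, with $I(\mu)=\iint\log|z-w|\,d\mu(z)d\mu(w)$ and $\mu$ ranging over Borel probability measures with compact support in $E$ (with $\mathrm{Cap}(\emptyset)=0$); $E$ is polar if $\mathrm{Cap}(E)=0$. For $E\subset\mathbb C^m$, $m\ge2$, let $\Gamma_m^{m-1}(E)$ be the set of $z\in\mathbb C^{m-1}$ such that $\{w\in\mathbb C:(z,w)\in E\}$ has positive capacity, and let $\Gamma_m^1(E)=\Gamma_2^1\circ\Gamma_3^2\circ\cdots\circ\Gamma_m^{m-1}(E)\subset\mathbb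 C$ (with $\Gamma_1^1(E)=E$ when $m=1$, so that $\Gamma$-capacity $0$ then means polar). Then $\Gamma\text{-Cap}(E)=\sup_{U\in U(m,\mathbb C)}\mathrm{Cap}\,\Gamma_m^1(U(E))$, $U$ ranging over unitary transformations of $\mathbb C^m$. *)

theory Defs
  imports
    "HOL-Complex_Analysis.Complex_Analysis"
    "HOL-Probability.Probability_Measure"
    "Jordan_Normal_Form.Schur_Decomposition"
begin

unbundle no vec_syntax

section \<open>Linearizability\<close>

text \<open>
  The germ of diffeomorphism is represented by an injective holomorphic function on an open
  neighbourhood \<open>S\<close> of the origin; the values of \<open>h\<close> outside \<open>S\<close> are irrelevant, whence the
  condition \<open>f z \<in> S\<close>.
\<close>

definition linearizable_at_0 :: "complex \<Rightarrow> (complex \<Rightarrow> complex) \<Rightarrow> bool" where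
  "linearizable_at_0 l f \<longleftrightarrow>
     (\<exists>h S. open S \<and> 0 \<in> S \<and> h holomorphic_on S \<and> inj_on h S \<and> h 0 = 0 \<and> deriv h 0 = 1 \<and>
            (\<forall>\<^sub>F z in nhds 0. z \<in> S \<and> f z \<in> S \<and> h (f z) = l * h z))"


section \<open>Logarithmic capacity in the plane\<close>

definition measure_support :: "'a::topological_space measure \<Rightarrow> 'a set" where
  "measure_support M = {x. \<forall>U. open U \<longrightarrow> x \<in> U \<longrightarrow> emeasure M U > 0}"

definition compact_prob_measures :: "complex set \<Rightarrow> complex measure set" where
  "compact_prob_measures E =
     {M. sets M = sets borel \<and> prob_space M \<and>
         compact (measure_support M) \<and> measure_support M \<subseteq> E}"

text \<open>
  The logarithm with \<open>log_abs 0 = - \<infinity>\<close>. The library's \<open>ln 0 = 0\<close> would give point masses energy \<open>0\<close>.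
\<close>

definition log_abs :: "complex \<Rightarrow> ereal" where
  "log_abs z = (if z = 0 then - \<infinity> else ereal (ln (cmod z)))"

text \<open>
  Extended integral as the difference of the integrals of the positive and the negative part
  (\<open>e2ennreal\<close> sends negative values to \<open>0\<close>). For a probability measure of compact support the
  positive part below has a finite integral, so that the difference is never \<open>\<infinity> - \<infinity>\<close>.
\<close>

definition extended_integral :: "'a measure \<Rightarrow> ('a \<Rightarrow> ereal) \<Rightarrow> ereal" where
  "extended_integral M f =
     enn2ereal (\<integral>\<^sup>+x. e2ennreal (f x) \<partial>M) - enn2ereal (\<integral>\<^sup>+x. e2ennreal (- f x) \<partial>M)"

definition log_energy :: "complex measure \<Rightarrow> ereal" where
  "log_energy M = extended_integral (M \<Otimes>\<^sub>M M) (\<lambda>(z, w). log_abs (z - w))"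

definition exp_ereal :: "ereal \<Rightarrow> ennreal" where
  "exp_ereal x = (case x of ereal r \<Rightarrow> ennreal (exp r) | PInfty \<Rightarrow> \<infinity> | MInfty \<Rightarrow> 0)"

text \<open>
  The supremum is taken in \<^typ>\<open>ennreal\<close>: it is \<open>0\<close> for the empty set and may be \<open>\<infinity>\<close> for
  unbounded sets.
\<close>

definition log_capacity :: "complex set \<Rightarrow> ennreal" where
  "log_capacity E = (SUP M \<in> compact_prob_measures E. exp_ereal (log_energy M))"


section \<open>\<open>\<Gamma>\<close>-capacity\<close>

text \<open>Here \<open>E\<close> is a subset of the space of vectors of dimension \<open>n + 1\<close>.\<close>

definition Gamma_step :: "nat \<Rightarrow> complex Matrix.vec set \<Rightarrow> complex Matrix.vec set" where
  "Gamma_step n E =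
     {z \<in> carrier_vec n. log_capacity {w. z @\<^sub>v vec_of_list [w] \<in> E} > 0}"

text \<open>Dimension \<open>0\<close> is a dummy case; in dimension \<open>1\<close> vectors are identified with their entry.\<close>

fun Gamma_proj :: "nat \<Rightarrow> complex Matrix.vec set \<Rightarrow> complex set" where
  "Gamma_proj 0 E = {}"
| "Gamma_proj (Suc 0) E = {w. vec_of_list [w] \<in> E}"
| "Gamma_proj (Suc (Suc n)) E = Gamma_proj (Suc n) (Gamma_step (Suc n) E)"

definition unitary_mats :: "nat \<Rightarrow> complex mat set" where
  "unitary_mats m = {U \<in> carrier_mat m m. mat_adjoint U * U = 1\<^sub>m m}"

definition Gamma_capacity :: "nat \<Rightarrow> complex Matrix.vec set \<Rightarrow> ennreal" where
  "Gamma_capacity m E =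
     (SUP U \<in> unitary_mats m. log_capacity (Gamma_proj m ((\<lambda>v. U *\<^sub>v v) ` E)))"


section \<open>Polynomial families\<close>

definition multi_indices :: "nat \<Rightarrow> nat \<Rightarrow> nat Matrix.vec set" where
  "multi_indices m d = {i \<in> carrier_vec m. (\<Sum>k<m. i $ k) \<le> d}"

definition multi_power :: "complex Matrix.vec \<Rightarrow> nat Matrix.vec \<Rightarrow> complex" where
  "multi_power t i = (\<Prod>k<dim_vec i. (t $ k) ^ (i $ k))"

definition poly_family ::
  "nat \<Rightarrow> nat \<Rightarrow> complex \<Rightarrow> (nat Matrix.vec \<Rightarrow> complex \<Rightarrow> complex) \<Rightarrow>
   complex Matrix.vec \<Rightarrow> complex \<Rightarrow> complex" where
  "poly_family m d l f t z = l * z + (\<Sum>i\<in>multi_indices m d. multi_power t i * f i z)"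

lemma finite_multi_indices: "finite (multi_indices m d)"
proof (rule finite_subset)
  show "multi_indices m d \<subseteq> vec_of_list ` {xs. set xs \<subseteq> {..d} \<and> length xs = m}"
  proof
    fix i assume i: "i \<in> multi_indices m d"
    then have dim: "dim_vec i = m" and le: "(\<Sum>k<m. i $ k) \<le> d"
      by (auto simp: multi_indices_def)
    have "i $ k \<le> d" if "k < m" for k
      using member_le_sum[of k "{..<m}" "\<lambda>k. i $ k"] that le by simp
    then have "set (list_of_vec i) \<subseteq> {..d}"
      using dim by (auto simp: set_list_of_vec vec_set_def)
    moreover have "i = vec_of_list (list_of_vec i)"
      by (simp add: vec_list)
    ultimately show "i \<in> vec_of_list ` {xs. set xs \<subseteq> {..d} \<and> length xs = m}"
      using dim by (intro image_eqI[where x = "list_of_vec i"]) auto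
  qed
qed (auto intro!: finite_imageI finite_lists_length_eq)

end

theory Submission
  imports Defs
begin

text \<open>
  The coefficients \<open>h\<^sub>n\<close> of the formal linearization are polynomials in the parameter of degree at
  most \<open>d n\<close>, and \<open>f\<^sub>t\<close> is linearizable iff \<open>h\<^sub>n(t)\<close> grows at most exponentially. On a complex line
  where this happens for a nonpolar set of parameters, the growth is uniform on a compact set
  carrying a measure with bounded potential, and a Bernstein--Walsh estimate spreads it to the
  whole line. A set that contains every complex line in which its trace is nonpolar, and which has
  positive \<open>\<Gamma>\<close>-capacity, is the whole space: by induction, if \<open>z\<close> is in the projection, then
  the fibre over \<open>z\<close> is a full line, so the projection inherits the property.
\<close>

section \<open>Logarithmic capacity and the Bernstein--Walsh estimate\<close>

text \<open>The complement of the support is a union of open null sets. By Lindelof, countably many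
  of them suffice, so it is itself null.\<close>

lemma AE_in_measure_support:
  fixes M :: "'a::second_countable_topology measure"
  assumes "sets M = sets borel"
  shows "AE x in M. x \<in> measure_support M"
proof -
  let ?\<F> = "{U. open U \<and> emeasure M U = 0}"
  obtain \<G> where \<G>: "\<G> \<subseteq> ?\<F>" "countable \<G>" "\<Union>\<G> = \<Union>?\<F>"
    using Lindelof[of ?\<F>] by auto
  have "(\<Union>U\<in>\<G>. U) \<in> null_sets M"
    using \<G> by (intro null_sets_UN') (auto simp: null_sets_def assms)
  moreover have "- measure_support M = \<Union>\<G>"
    unfolding \<G>(3) measure_support_def by (auto simp: zero_less_iff_neq_zero)
  ultimately show ?thesis
    by (intro AE_I'[of "\<Union>\<G>"]) auto
qed

text \<open>The positive part of \<open>- ln |z|\<close>, so pairs at distance at least 1 contribute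
  0. Being nonnegative, it can be integrated without any integrability condition.\<close>

definition log_kernel :: "complex \<Rightarrow> ennreal" where
  "log_kernel z = e2ennreal (- log_abs z)"

lemma borel_measurable_log_abs [measurable]: "log_abs \<in> borel_measurable borel"
  unfolding log_abs_def by measurable

lemma borel_measurable_log_kernel [measurable]: "log_kernel \<in> borel_measurable borel"
  unfolding log_kernel_def by measurable

lemma log_kernel_0 [simp]: "log_kernel 0 = \<infinity>"
  and log_kernel_nonzero: "z \<noteq> 0 \<Longrightarrow> log_kernel z = ennreal (- ln (cmod z))"
  by (auto simp: log_kernel_def log_abs_def)

lemma log_kernel_le_double:
  assumes "cmod u \<le> 2 * cmod v"
  shows "log_kernel v \<le> log_kernel u + ennreal (ln 2)"
proof (cases "u = 0")
  case False
  then have v: "v \<noteq> 0" using assms by auto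
  have "ln (cmod u) \<le> ln (2 * cmod v)"
    using assms False v by (subst ln_le_cancel_iff) auto
  then have "- ln (cmod v) \<le> - ln (cmod u) + ln 2"
    using v by (simp add: ln_mult)
  then have "ennreal (- ln (cmod v)) \<le> ennreal (max 0 (- ln (cmod u)) + ln 2)"
    by (intro ennreal_leI) auto
  also have "\<dots> = ennreal (max 0 (- ln (cmod u))) + ennreal (ln 2)"
    by (intro ennreal_plus) auto
  finally show ?thesis
    using False v by (simp add: log_kernel_nonzero ennreal_max_0 max.commute)
qed auto

lemma log_capacity_mono: "A \<subseteq> B \<Longrightarrow> log_capacity A \<le> log_capacity B"
  unfolding log_capacity_def compact_prob_measures_def by (intro SUP_subset_mono) auto

text \<open>Almost every point lies in the support, so no probability measure has empty
  support.\<close>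

lemma log_capacity_pos_nonempty:
  assumes "log_capacity A > 0" shows "A \<noteq> {}"
proof
  assume "A = {}"
  with assms obtain M :: "complex measure" where M: "sets M = sets borel" "prob_space M" "measure_support M = {}"
    unfolding log_capacity_def compact_prob_measures_def by (auto simp: less_SUP_iff)
  then have "AE x in M. False" using AE_in_measure_support[OF M(1)] by simp
  with prob_space.AE_False[OF M(2)] show False by simp
qed

text \<open>On a compact support |z - w| is bounded, and ln x \<le> x - 1 then bounds the positive
  part of the logarithm. Hence an energy of -\<infinity> can only come from the negative
  part.\<close>

lemma nn_integral_log_abs_finite:
  assumes [measurable_cong]: "sets M = sets borel" and "prob_space M" "compact (measure_support M)"
  shows "(\<integral>\<^sup>+(z, w). e2ennreal (log_abs (z - w)) \<partial>(M \<Otimes>\<^sub>M M)) < \<infinity>"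
proof -
  interpret prob_space M by fact
  obtain R where R: "\<And>x. x \<in> measure_support M \<Longrightarrow> cmod x \<le> R"
    using compact_imp_bounded[OF assms(3)] by (auto simp: bounded_iff)
  have AE: "AE x in M. cmod x \<le> R"
    using AE_in_measure_support[OF assms(1)] by eventually_elim (rule R)
  have le: "e2ennreal (log_abs (z - w)) \<le> ennreal (2 * R)" if "cmod z \<le> R" "cmod w \<le> R" for z w
  proof (cases "z = w")
    case False
    have "ln (cmod (z - w)) \<le> cmod (z - w) - 1"
      using False by (intro ln_le_minus_one) auto
    also have "\<dots> \<le> 2 * R"
      using norm_triangle_ineq4[of z w] that by linarith
    finally show ?thesis using False by (auto simp: log_abs_def intro!: ennreal_leI)
  qed (auto simp: log_abs_def e2ennreal_neg)
  have "(\<integral>\<^sup>+(z, w). e2ennreal (log_abs (z - w)) \<partial>(M \<Otimes>\<^sub>M M))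
      = (\<integral>\<^sup>+z. \<integral>\<^sup>+w. e2ennreal (log_abs (z - w)) \<partial>M \<partial>M)"
    by (subst nn_integral_fst[symmetric]) (auto simp: case_prod_unfold)
  also have "\<dots> \<le> (\<integral>\<^sup>+z. \<integral>\<^sup>+w. ennreal (2 * R) \<partial>M \<partial>M)"
  proof (intro nn_integral_mono_AE)
    show "AE z in M. (\<integral>\<^sup>+w. e2ennreal (log_abs (z - w)) \<partial>M) \<le> (\<integral>\<^sup>+w. ennreal (2 * R) \<partial>M)"
      using AE
    proof eventually_elim
      case (elim z)
      from AE have "AE w in M. e2ennreal (log_abs (z - w)) \<le> ennreal (2 * R)"
        by eventually_elim (rule le[OF elim])
      then show ?case by (rule nn_integral_mono_AE)
    qed
  qed
  also have "\<dots> < \<infinity>" by (simp add: emeasure_space_1)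
  finally show ?thesis .
qed

text \<open>A positive supremum yields a measure whose energy is not -\<infinity>. Its positive part
  is finite, so the negative part must be finite too.\<close>

lemma log_capacity_posE:
  assumes "log_capacity E > 0"
  obtains M where "sets M = sets borel" "prob_space M" "AE x in M. x \<in> E"
    "(\<integral>\<^sup>+z. \<integral>\<^sup>+w. log_kernel (z - w) \<partial>M \<partial>M) < \<infinity>"
proof -
  from assms obtain M where M: "sets M = sets borel" "prob_space M" "compact (measure_support M)"
      "measure_support M \<subseteq> E" and energy: "exp_ereal (log_energy M) > 0"
    unfolding log_capacity_def compact_prob_measures_def by (auto simp: less_SUP_iff)
  interpret prob_space M by fact
  note [measurable_cong] = M(1)
  let ?P = "\<integral>\<^sup>+(z, w). e2ennreal (log_abs (z - w)) \<partial>(M \<Otimes>\<^sub>M M)"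
  let ?N = "\<integral>\<^sup>+(z, w). log_kernel (z - w) \<partial>(M \<Otimes>\<^sub>M M)"
  have "log_energy M = enn2ereal ?P - enn2ereal ?N"
    by (simp add: log_energy_def extended_integral_def log_kernel_def case_prod_unfold)
  moreover have "log_energy M \<noteq> - \<infinity>"
    using energy by (auto simp: exp_ereal_def)
  moreover have "?P < \<infinity>" using nn_integral_log_abs_finite M by blast
  ultimately have "?N < \<infinity>"
    by (cases ?P; cases ?N) (auto simp: less_top)
  also have "?N = (\<integral>\<^sup>+z. \<integral>\<^sup>+w. log_kernel (z - w) \<partial>M \<partial>M)"
    by (subst nn_integral_fst[symmetric]) (auto simp: case_prod_unfold)
  finally have fin: "(\<integral>\<^sup>+z. \<integral>\<^sup>+w. log_kernel (z - w) \<partial>M \<partial>M) < \<infinity>" .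
  have AE: "AE x in M. x \<in> E" 
    using AE_in_measure_support[OF M(1)] by eventually_elim (use M(4) in auto)
  show thesis
    by (rule that[OF M(1,2) AE fin])
qed

text \<open>
  The potential of \<open>M\<close> is bounded on a set of positive measure; comparing an arbitrary point with
  the point of \<open>K\<close> nearest to it bounds the potential of the restriction to \<open>K\<close> on the whole plane.
\<close>

lemma compact_bounded_potential:
  assumes "log_capacity E > 0" "E \<subseteq> (\<Union>k::nat. A k)" "\<And>k. closed (A k)"
  obtains k K and M :: "complex measure" and B :: real
  where "compact K" "K \<subseteq> A k" "sets M = sets borel" "0 < emeasure M K" "emeasure M K < \<infinity>" "0 \<le> B"
    "\<And>w. (\<integral>\<^sup>+z\<in>K. log_kernel (z - w) \<partial>M) \<le> ennreal B"
proof -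
  from log_capacity_posE[OF assms(1)] obtain M where M: "sets M = sets borel" "prob_space M"
    "AE x in M. x \<in> E" "(\<integral>\<^sup>+z. \<integral>\<^sup>+w. log_kernel (z - w) \<partial>M \<partial>M) < \<infinity>" by metis
  interpret prob_space M by fact
  note [measurable_cong] = M(1)
  define p where "p z = (\<integral>\<^sup>+w. log_kernel (z - w) \<partial>M)" for z
  have [measurable]: "p \<in> borel_measurable M" unfolding p_def by measurable
  have [measurable]: "A k \<in> sets M" for k using assms(3) M(1) by auto
  \<comment> \<open>Finite energy makes the potential \<open>p\<close> finite almost everywhere, so
    these countably many sets cover almost all of the plane and one of them has positive mass. Inner
    regularity then supplies the compact \<open>K\<close> inside it.\<close>
  define T where "T k j = {z \<in> space M. z \<in> A k \<and> p z \<le> of_nat j}" for k j :: nat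
  have [measurable]: "T k j \<in> sets M" for k j unfolding T_def by measurable
  have "AE z in M. p z \<noteq> \<infinity>"
    by (rule nn_integral_noteq_infinite) (use M(4) in \<open>auto simp: p_def\<close>)
  with M(3) have AE_T: "AE z in M. z \<in> (\<Union>k. \<Union>j. T k j)"
  proof (eventually_elim)
    case (elim z)
    then obtain k where "z \<in> A k" using assms(2) by auto
    moreover obtain j :: nat where "p z \<le> of_nat j"
      using elim(2) ennreal_Ex_less_of_nat[of "p z"] by (auto simp: less_top intro: less_imp_le)
    ultimately show ?case by (auto simp: T_def sets_eq_imp_space_eq[OF M(1)])
  qed
  have "\<not> (\<forall>k j. T k j \<in> null_sets M)"
  proof
    assume "\<forall>k j. T k j \<in> null_sets M"
    then have "(\<Union>k. \<Union>j. T k j) \<in> null_sets M" by (intro null_sets_UN) auto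
    then have "AE z in M. z \<notin> (\<Union>k. \<Union>j. T k j)" by (rule AE_not_in)
    with AE_T have "AE z in M. False" by eventually_elim auto
    then show False by simp
  qed
  then obtain k j where kj: "emeasure M (T k j) > 0"
    by (auto simp: null_sets_def zero_less_iff_neq_zero)
  moreover have "emeasure M (T k j) = (SUP K \<in> {K. K \<subseteq> T k j \<and> compact K}. emeasure M K)"
  proof (rule inner_regular)
    show "T k j \<in> sets borel" using \<open>T k j \<in> sets M\<close> unfolding M(1) .
  qed (simp_all add: M(1))
  ultimately obtain K where K: "K \<subseteq> T k j" "compact K" "emeasure M K > 0"
    by (auto simp: less_SUP_iff)
  have [measurable]: "K \<in> sets M" unfolding M(1) by (rule borel_closed[OF compact_imp_closed[OF K(2)]])
  have bound: "(\<integral>\<^sup>+z\<in>K. log_kernel (z - w) \<partial>M) \<le> ennreal (real j + ln 2)" for w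
  proof -
    have "K \<noteq> {}" using K(3) by auto
    then obtain a where a: "a \<in> K" "\<And>z. z \<in> K \<Longrightarrow> dist w a \<le> dist w z"
      using continuous_attains_inf[OF K(2), of "dist w"] continuous_on_dist[OF continuous_on_const continuous_on_id]
      by blast
    \<comment> \<open>As \<open>a\<close> is nearest to \<open>w\<close>, |a - z| \<le> |a - w| + |w
      - z| \<le> 2 |z - w|.\<close>
    have "log_kernel (z - w) \<le> log_kernel (a - z) + ennreal (ln 2)" if "z \<in> K" for z
      using a(2)[OF that] dist_triangle[of a z w]
      by (intro log_kernel_le_double) (auto simp: dist_norm norm_minus_commute)
    \<comment> \<open>Integrating over the whole plane instead of \<open>K\<close> recovers the full
      potential at \<open>a\<close>, which is at most \<open>j\<close> because \<open>a\<close> lies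
      in \<open>T k j\<close>.\<close>
    then have "(\<integral>\<^sup>+z\<in>K. log_kernel (z - w) \<partial>M) \<le> (\<integral>\<^sup>+z. log_kernel (a - z) + ennreal (ln 2) \<partial>M)"
      by (intro nn_integral_mono) (auto simp: indicator_def)
    also have "\<dots> = p a + ennreal (ln 2)"
      by (simp add: nn_integral_add p_def emeasure_space_1)
    also have "\<dots> \<le> of_nat j + ennreal (ln 2)"
      using a(1) K(1) by (intro add_mono) (auto simp: T_def)
    also have "\<dots> = ennreal (real j + ln 2)"
      by (simp add: ennreal_of_nat_eq_real_of_nat)
    finally show ?thesis .
  qed
  show thesis
    by (rule that[of K k M "real j + ln 2"]) (use K M(1) bound in \<open>auto simp: T_def less_top[symmetric]\<close>)
qed

text \<open>
  Averaged over \<open>K\<close>, the ratio of \<open>\<bar>w - a\<bar>\<close> and \<open>\<bar>z - a\<bar>\<close> is bounded on the logarithmic scale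
  uniformly in the root \<open>a\<close>, so some \<open>z \<in> K\<close> is good for all roots together.
\<close>

lemma bernstein_walsh:
  fixes M :: "complex measure"
  assumes "compact K" "sets M = sets borel" "0 < emeasure M K" "emeasure M K < \<infinity>" "0 \<le> B"
    and bound: "\<And>w. (\<integral>\<^sup>+z\<in>K. log_kernel (z - w) \<partial>M) \<le> ennreal B"
  shows "\<exists>C\<ge>1. \<forall>p. \<exists>z\<in>K. cmod (poly p w) \<le> cmod (poly p z) * C ^ degree p"
proof -
  have "K \<noteq> {}" using assms(3) by auto
  define \<mu> where "\<mu> = measure M K"
  have \<mu>: "emeasure M K = ennreal \<mu>"
    unfolding \<mu>_def using assms(4) by (intro emeasure_eq_ennreal_measure) auto
  then have "\<mu> > 0" using assms(3) by simp
  note \<mu> = \<mu> this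
  obtain R where R: "\<And>z. z \<in> K \<Longrightarrow> cmod (w - z) \<le> R" "R \<ge> 0"
  proof -
    from compact_imp_bounded[OF assms(1)] obtain R' where "\<And>z. z \<in> K \<Longrightarrow> cmod z \<le> R'"
      by (auto simp: bounded_iff)
    then have "\<And>z. z \<in> K \<Longrightarrow> cmod (w - z) \<le> cmod w + \<bar>R'\<bar>"
      by (smt (verit) norm_triangle_ineq4)
    then show thesis by (rule that) auto
  qed
  note [measurable_cong] = assms(2)
  have [measurable]: "K \<in> sets M" unfolding assms(2) by (rule borel_closed[OF compact_imp_closed[OF assms(1)]])
  \<comment> \<open>The average over \<open>K\<close> of the kernel of a single root is at most
    \<open>B / \<mu>\<close>. The extra 1 makes the averaging argument strict.\<close>
  define b where "b = B / \<mu> + 1"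
  \<comment> \<open>The loss per root: \<open>1 + R\<close> from moving \<open>z\<close> to
    \<open>w\<close>, and \<open>exp b\<close> for the closeness of \<open>z\<close> to the
    roots.\<close>
  define C where "C = (1 + R) * exp b"
  have "C \<ge> 1"
  proof -
    have "1 * 1 \<le> (1 + R) * exp b"
      using R(2) \<mu>(2) assms(5) by (intro mult_mono) (auto simp: b_def)
    then show ?thesis by (simp add: C_def)
  qed
  moreover have "\<exists>z\<in>K. cmod (poly p w) \<le> cmod (poly p z) * C ^ degree p" for p
  proof (cases "p = 0")
    case False
    then obtain S where S: "size S = degree p" "p = Polynomial.smult (lead_coeff p) (\<Prod>a\<in>#S. [:-a, 1:])"
      using alg_closed_imp_factorization by blast
    have poly: "poly p x = lead_coeff p * (\<Prod>a\<in>#S. x - a)" for x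
      by (subst S(2)) (simp add: poly_prod_mset)
    have int: "(\<integral>\<^sup>+z\<in>K. (\<Sum>a\<in>#N. log_kernel (z - a)) \<partial>M) \<le> ennreal (real (size N) * B)" for N
    proof (induction N)
      case (add a N)
      have [measurable]: "(\<lambda>z. \<Sum>a\<in>#N. log_kernel (z - a)) \<in> borel_measurable M"
        by (induction N) auto
      have "(\<integral>\<^sup>+z\<in>K. (\<Sum>a\<in>#add_mset a N. log_kernel (z - a)) \<partial>M) =
            (\<integral>\<^sup>+z\<in>K. log_kernel (z - a) \<partial>M) + (\<integral>\<^sup>+z\<in>K. (\<Sum>a\<in>#N. log_kernel (z - a)) \<partial>M)"
        by (subst nn_integral_add[symmetric]) (auto simp: distrib_right)
      also have "\<dots> \<le> ennreal B + ennreal (real (size N) * B)"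
        by (intro add_mono bound add)
      also have "\<dots> = ennreal (real (size (add_mset a N)) * B)"
        using assms(5) by (subst ennreal_plus[symmetric]) (auto simp: algebra_simps)
      finally show ?case .
    qed auto
    \<comment> \<open>If the sum exceeded \<open>size S * b\<close> on all of \<open>K\<close>,
      integration would give size S (B + \<mu>) \<le> size S B, so there would be no roots; but then
      the sum is 0 and the bound holds.\<close>
    have "\<exists>z\<in>K. (\<Sum>a\<in>#S. log_kernel (z - a)) \<le> ennreal (real (size S) * b)"
    proof (rule ccontr)
      assume neg: "\<not> ?thesis"
      then have "(\<integral>\<^sup>+z\<in>K. ennreal (real (size S) * b) \<partial>M) \<le> (\<integral>\<^sup>+z\<in>K. (\<Sum>a\<in>#S. log_kernel (z - a)) \<partial>M)"
        by (intro nn_integral_mono) (auto simp: indicator_def not_le intro: less_imp_le)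
      also note int
      also have "(\<integral>\<^sup>+z\<in>K. ennreal (real (size S) * b) \<partial>M) = ennreal (real (size S) * b * \<mu>)"
        using \<mu> assms(5) by (simp add: nn_integral_cmult_indicator ennreal_mult b_def)
      finally have "real (size S) * (b * \<mu>) \<le> real (size S) * B"
        using assms(5) by (simp add: ennreal_le_iff mult.assoc)
      moreover have "b * \<mu> = B + \<mu>" using \<mu>(2) by (simp add: b_def field_simps)
      ultimately have "size S = 0"
        using \<mu>(2) by (simp add: distrib_left mult_le_0_iff)
      then show False
        using neg \<open>K \<noteq> {}\<close> by auto
    qed
    then obtain z where z: "z \<in> K" "(\<Sum>a\<in>#S. log_kernel (z - a)) \<le> ennreal (real (size S) * b)"
      by blast
    \<comment> \<open>Here \<open>s\<close> is a budget for the kernels: a root \<open>a\<close>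
      spends \<open>u\<close> of it and leaves \<open>s - u\<close> to the remaining roots, which is
      why \<open>s\<close> varies in the induction.\<close>
    have prod: "cmod (\<Prod>a\<in>#N. w - a) \<le> cmod (\<Prod>a\<in>#N. z - a) * (1 + R) ^ size N * exp s"
      if "(\<Sum>a\<in>#N. log_kernel (z - a)) \<le> ennreal s" "s \<ge> 0" for N s
      using that
    proof (induction N arbitrary: s)
      case (add a N)
      from add.prems have le: "log_kernel (z - a) + (\<Sum>a\<in>#N. log_kernel (z - a)) \<le> ennreal s"
        by simp
      have za: "z \<noteq> a" using le by (auto simp: top_unique)
      define u where "u = max 0 (- ln (cmod (z - a)))"
      have u: "log_kernel (z - a) = ennreal u" "u \<ge> 0"
        using za by (auto simp: log_kernel_nonzero u_def ennreal_max_0 max.commute)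
      have "ennreal u \<le> ennreal s" using le u by (metis le_iff_add order_trans)
      then have us: "u \<le> s" using add.prems by (simp add: ennreal_le_iff)
      have "(\<Sum>a\<in>#N. log_kernel (z - a)) \<le> ennreal s - ennreal u"
        using le u(1) by (simp add: ennreal_le_minus_iff add.commute)
      also have "\<dots> = ennreal (s - u)" using u by (simp add: ennreal_minus)
      finally have IH: "cmod (\<Prod>a\<in>#N. w - a) \<le> cmod (\<Prod>a\<in>#N. z - a) * (1 + R) ^ size N * exp (s - u)"
        using us by (intro add.IH) auto
      \<comment> \<open>This turns the additive error \<open>R\<close> in |w - a| \<le> R + |z - a|
        into a multiple of |z - a|.\<close>
      have "1 \<le> cmod (z - a) * exp u"
      proof -
        have "exp (ln (cmod (z - a)) + u) \<ge> 1" by (subst one_le_exp_iff) (simp add: u_def)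
        then show ?thesis using za by (simp add: exp_add)
      qed
      then have "R * 1 \<le> R * (cmod (z - a) * exp u)" using R(2) by (intro mult_left_mono)
      moreover have "cmod (z - a) \<le> cmod (z - a) * exp u"
        using u(2) by (simp add: mult_le_cancel_left1)
      moreover have "cmod (w - a) \<le> cmod (w - z) + cmod (z - a)"
        using norm_triangle_ineq[of "w - z" "z - a"] by simp
      ultimately have "cmod (w - a) \<le> cmod (z - a) * (1 + R) * exp u"
        using R(1)[OF z(1)] by (simp add: algebra_simps)
      then have "cmod (w - a) * cmod (\<Prod>a\<in>#N. w - a) \<le>
        (cmod (z - a) * (1 + R) * exp u) * (cmod (\<Prod>a\<in>#N. z - a) * (1 + R) ^ size N * exp (s - u))"
        using IH R(2) by (intro mult_mono) auto
      also have "\<dots> = cmod (\<Prod>a\<in>#add_mset a N. z - a) * (1 + R) ^ size (add_mset a N) * exp s"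
        by (simp add: norm_mult exp_diff)
      finally show ?case by (simp add: norm_mult)
    qed auto
    have "b \<ge> 0" using \<mu>(2) assms(5) by (simp add: b_def)
    from prod[OF z(2)] this have "cmod (\<Prod>a\<in>#S. w - a) \<le> cmod (\<Prod>a\<in>#S. z - a) * C ^ degree p"
      by (simp add: C_def S(1) power_mult_distrib exp_of_nat_mult mult.assoc)
    then have "cmod (poly p w) \<le> cmod (poly p z) * C ^ degree p"
      unfolding poly norm_mult by (simp add: mult.assoc mult_left_mono)
    then show ?thesis using z(1) by blast
  qed (use \<open>K \<noteq> {}\<close> in auto)
  ultimately show ?thesis by blast
qed

text \<open>The degree is at most linear in n, so the Bernstein--Walsh loss
  \<open>C ^ degree\<close> is again exponential and only changes the rate.\<close>

lemma exponential_growth_dichotomy: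
  fixes p :: "nat \<Rightarrow> complex poly"
  assumes deg: "\<And>n. degree (p n) \<le> D * n"
    and cap: "log_capacity {w. \<exists>k::nat. \<forall>n. cmod (poly (p n) w) \<le> real k ^ n} > 0"
  shows "\<exists>k::nat. \<forall>n. cmod (poly (p n) w) \<le> real k ^ n"
proof -
  \<comment> \<open>Fixing the rate gives closed sets, and countably many of them exhaust the set of
    exponential growth.\<close>
  define A where "A k = {w. \<forall>n. cmod (poly (p n) w) \<le> real k ^ n}" for k :: nat
  have closed: "closed (A k)" for k
    unfolding A_def by (intro closed_Collect_all closed_Collect_le continuous_intros)
  have cover: "{w. \<exists>k::nat. \<forall>n. cmod (poly (p n) w) \<le> real k ^ n} \<subseteq> (\<Union>k. A k)"
    by (auto simp: A_def)
  obtain k K M B where K: "compact K" "K \<subseteq> A k" "sets M = sets borel"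
    "0 < emeasure M K" "emeasure M K < \<infinity>" "0 \<le> B"
    "\<And>w. (\<integral>\<^sup>+z\<in>K. log_kernel (z - w) \<partial>M) \<le> ennreal B"
    by (rule compact_bounded_potential[OF cap cover closed]) blast
  \<comment> \<open>The constant depends on \<open>w\<close>, which suffices because growth is only
    claimed at the single point \<open>w\<close>.\<close>
  obtain C where C: "C \<ge> 1" "\<And>p. \<exists>z\<in>K. cmod (poly p w) \<le> cmod (poly p z) * C ^ degree p"
    using bernstein_walsh[OF K(1,3-7)] by metis
  obtain k' :: nat where k': "real k * C ^ D \<le> real k'" using real_arch_simple by blast
  have "cmod (poly (p n) w) \<le> real k' ^ n" for n
  proof -
    obtain z where z: "z \<in> K" "cmod (poly (p n) w) \<le> cmod (poly (p n) z) * C ^ degree (p n)"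
      using C(2) by blast
    note z(2)
    also have "\<dots> \<le> real k ^ n * C ^ (D * n)"
      using K(2) z(1) C(1) deg by (intro mult_mono power_increasing) (auto simp: A_def)
    also have "\<dots> = (real k * C ^ D) ^ n" by (simp add: power_mult_distrib power_mult)
    also have "\<dots> \<le> real k' ^ n" using C(1) k' by (intro power_mono) auto
    finally show ?thesis .
  qed
  then show ?thesis by blast
qed

section \<open>The formal linearization\<close>

text \<open>
  The recursion compares the coefficients of \<open>z\<^sup>n\<close> in \<open>h \<circ> F = l h\<close>, where \<open>l\<close> is the
  linear coefficient of \<open>F\<close> and \<open>h = z + \<dots>\<close>.
\<close>

fun linearization_coeff :: "complex fps \<Rightarrow> nat \<Rightarrow> complex" where
  "linearization_coeff F n =
     (if n = 0 then 0 else if n = 1 then 1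
      else (\<Sum>j<n. linearization_coeff F j * fps_nth (F ^ j) n) / (fps_nth F 1 - fps_nth F 1 ^ n))"

declare linearization_coeff.simps [simp del]

lemma linearization_coeff_0 [simp]: "linearization_coeff F 0 = 0"
  and linearization_coeff_1 [simp]: "linearization_coeff F (Suc 0) = 1"
  by (simp_all add: linearization_coeff.simps)

text \<open>Isolates the only term with the n-th coefficient of \<open>H\<close>. Its factor l^n,
  with l = \<open>fps_nth F 1\<close>, produces the divisor l - l^n of the recursion.\<close>

lemma fps_compose_nth_split:
  fixes F H :: "complex fps"
  assumes "fps_nth F 0 = 0"
  shows "fps_nth (fps_compose H F) n =
    (\<Sum>j<n. fps_nth H j * fps_nth (F ^ j) n) + fps_nth H n * fps_nth F 1 ^ n"
proof -
  have "fps_nth (F ^ n) n = fps_nth F 1 ^ n"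
    using assms by (rule startsby_zero_power_nth_same)
  moreover have "{0..n} = insert n {..<n}" by auto
  ultimately show ?thesis
    by (simp add: fps_compose_nth)
qed

text \<open>The divisors l - l^n do not vanish for n \<ge> 2, so the equation determines each
  coefficient from the earlier ones. This identifies the Taylor series of any analytic
  linearization.\<close>

lemma linearization_coeff_unique:
  assumes F: "fps_nth F 0 = 0" "\<And>n. n \<ge> 2 \<Longrightarrow> fps_nth F 1 ^ n \<noteq> fps_nth F 1"
    and H: "fps_nth H 0 = 0" "fps_nth H 1 = 1" "fps_compose H F = fps_const (fps_nth F 1) * H"
  shows "fps_nth H n = linearization_coeff F n"
proof (induction n rule: less_induct)
  case (less n)
  consider "n = 0" | "n = 1" | "n \<ge> 2" by linarith
  then show ?case
  proof cases
    case 3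
    have "(\<Sum>j<n. fps_nth H j * fps_nth (F ^ j) n) = (\<Sum>j<n. linearization_coeff F j * fps_nth (F ^ j) n)"
      using less by simp
    moreover have "(\<Sum>j<n. fps_nth H j * fps_nth (F ^ j) n) + fps_nth H n * fps_nth F 1 ^ n = fps_nth F 1 * fps_nth H n"
      using arg_cong[OF H(3), of "\<lambda>G. fps_nth G n"] fps_compose_nth_split[OF F(1)] by simp
    ultimately have "(\<Sum>j<n. linearization_coeff F j * fps_nth (F ^ j) n) =
        fps_nth H n * (fps_nth F 1 - fps_nth F 1 ^ n)"
      by (simp add: algebra_simps)
    with F(2)[OF 3] 3 show ?thesis
      by (subst linearization_coeff.simps) (auto simp: field_simps)
  qed (use H in auto)
qed

lemma linearization_coeff_solves:
  assumes F: "fps_nth F 0 = 0" "\<And>n. n \<ge> 2 \<Longrightarrow> fps_nth F 1 ^ n \<noteq> fps_nth F 1"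
  shows "fps_compose (Abs_fps (linearization_coeff F)) F
    = fps_const (fps_nth F 1) * Abs_fps (linearization_coeff F)"
proof (rule fps_ext)
  fix n :: nat
  consider "n = 0" | "n = 1" | "n \<ge> 2" by linarith
  then show "fps_nth (fps_compose (Abs_fps (linearization_coeff F)) F) n =
      fps_nth (fps_const (fps_nth F 1) * Abs_fps (linearization_coeff F)) n"
  proof cases
    case 3
    have "(\<Sum>j<n. linearization_coeff F j * fps_nth (F ^ j) n) =
        linearization_coeff F n * (fps_nth F 1 - fps_nth F 1 ^ n)"
      using F(2)[OF 3] 3 by (subst (2) linearization_coeff.simps) auto
    then show ?thesis
      by (subst fps_compose_nth_split[OF F(1)]) (simp add: algebra_simps)
  qed (simp_all add: fps_compose_nth_split[OF F(1)])
qed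

text \<open>Cauchy--Hadamard with a natural number as rate, so that the rates are countable. A
  multiplicative constant is absorbed into the rate for n \<ge> 1, and the coefficient at n = 0
  vanishes.\<close>

lemma fps_conv_radius_pos_iff:
  fixes H :: "complex fps"
  assumes "fps_nth H 0 = 0"
  shows "fps_conv_radius H > 0 \<longleftrightarrow> (\<exists>k::nat. \<forall>n. cmod (fps_nth H n) \<le> real k ^ n)"
proof
  assume "fps_conv_radius H > 0"
  then obtain r where r: "0 < ereal r" "ereal r < fps_conv_radius H"
    using ereal_dense2[of 0 "fps_conv_radius H"] by auto
  then have "summable (\<lambda>n. fps_nth H n * of_real r ^ n)"
    by (intro summable_fps) auto
  then have "Bseq (\<lambda>n. fps_nth H n * of_real r ^ n)"
    by (intro convergent_imp_Bseq) (auto simp: convergent_def dest: summable_LIMSEQ_zero)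
  then obtain K where K: "K > 0" "\<And>n. cmod (fps_nth H n * of_real r ^ n) \<le> K"
    by (auto simp: Bseq_def)
  obtain k :: nat where k: "max 1 K / r \<le> real k" using real_arch_simple by blast
  have "cmod (fps_nth H n) \<le> real k ^ n" for n
  proof (cases "n = 0")
    case False
    have "cmod (fps_nth H n) \<le> K / r ^ n"
      using K(2)[of n] r(1) by (simp add: norm_mult norm_power field_simps)
    also have "\<dots> \<le> max 1 K ^ n / r ^ n"
    proof (intro divide_right_mono)
      have "max 1 K ^ 1 \<le> max 1 K ^ n" using False by (intro power_increasing) auto
      then show "K \<le> max 1 K ^ n" by simp
    qed (use r(1) in auto)
    also have "\<dots> = (max 1 K / r) ^ n" by (simp add: power_divide)
    also have "\<dots> \<le> real k ^ n" using k r(1) by (intro power_mono) auto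
    finally show ?thesis .
  qed (use assms in auto)
  then show "\<exists>k::nat. \<forall>n. cmod (fps_nth H n) \<le> real k ^ n" by blast
next
  assume "\<exists>k::nat. \<forall>n. cmod (fps_nth H n) \<le> real k ^ n"
  then obtain k :: nat where k: "\<And>n. cmod (fps_nth H n) \<le> real k ^ n" by blast
  \<comment> \<open>At this radius the terms are at most 2^(-n); the \<open>+ 1\<close> covers k =
    0.\<close>
  let ?r = "of_real (1 / (2 * (real k + 1))) :: complex"
  have "summable (\<lambda>n. fps_nth H n * ?r ^ n)"
  proof (rule summable_comparison_test')
    show "summable (\<lambda>n. (1/2) ^ n :: real)" by (intro summable_geometric) auto
  next
    fix n
    have "cmod (fps_nth H n * ?r ^ n) = cmod (fps_nth H n) * (1 / (2 * (real k + 1))) ^ n"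
      by (simp only: norm_mult norm_power norm_of_real) simp
    also have "\<dots> \<le> real k ^ n * (1 / (2 * (real k + 1))) ^ n"
      by (intro mult_right_mono k) auto
    also have "\<dots> = (real k * (1 / (2 * (real k + 1)))) ^ n" by (simp only: power_mult_distrib)
    also have "\<dots> \<le> (1 / 2) ^ n"
      by (intro power_mono) (auto simp: field_simps)
    finally show "norm (fps_nth H n * ?r ^ n) \<le> (1 / 2) ^ n" .
  qed
  then have "conv_radius (fps_nth H) \<ge> norm ?r" by (rule conv_radius_geI)
  moreover have "norm ?r > 0" unfolding norm_of_real by auto
  ultimately show "fps_conv_radius H > 0"
    unfolding fps_conv_radius_def by (metis ereal_less(2) less_le_trans)
qed

text \<open>The Taylor series of a linearizing germ is the formal solution, by uniqueness.
  Conversely, a convergent formal solution defines the germ.\<close>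

lemma linearizable_at_0_iff:
  assumes f: "f has_fps_expansion F" "fps_nth F 0 = 0" "fps_nth F 1 = l"
    and l: "\<And>n. n \<ge> 2 \<Longrightarrow> l ^ n \<noteq> l"
  shows "linearizable_at_0 l f \<longleftrightarrow> (\<exists>k::nat. \<forall>n. cmod (linearization_coeff F n) \<le> real k ^ n)"
proof
  assume "linearizable_at_0 l f"
  then obtain h S where h: "open S" "0 \<in> S" "h holomorphic_on S" "h 0 = 0" "deriv h 0 = 1"
    "\<forall>\<^sub>F z in nhds 0. z \<in> S \<and> f z \<in> S \<and> h (f z) = l * h z"
    unfolding linearizable_at_0_def by blast
  define H where "H = fps_expansion h 0"
  have H: "h has_fps_expansion H"
    unfolding H_def using h by (intro has_fps_expansion_fps_expansion)
  have "(h \<circ> f) has_fps_expansion fps_compose H F"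
    by (intro has_fps_expansion_compose H f)
  also have "?this \<longleftrightarrow> (\<lambda>z. l * h z) has_fps_expansion fps_compose H F"
    using h(6) by (intro has_fps_expansion_cong) (auto elim: eventually_mono)
  finally have "fps_compose H F = fps_const l * H"
    by (rule fps_expansion_unique_complex) (intro fps_expansion_intros H)
  then have coeff: "fps_nth H n = linearization_coeff F n" for n
    using f l h fps_nth_fps_expansion[OF H]
    by (intro linearization_coeff_unique) auto
  have "fps_conv_radius H > 0" using H by (simp add: has_fps_expansion_def)
  then show "\<exists>k::nat. \<forall>n. cmod (linearization_coeff F n) \<le> real k ^ n"
    by (subst (asm) fps_conv_radius_pos_iff) (simp_all add: coeff)
next
  assume growth: "\<exists>k::nat. \<forall>n. cmod (linearization_coeff F n) \<le> real k ^ n"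
  define H where "H = Abs_fps (linearization_coeff F)"
  have conv: "fps_conv_radius H > 0"
    by (subst fps_conv_radius_pos_iff) (use growth in \<open>auto simp: H_def\<close>)
  let ?h = "eval_fps H" and ?S = "eball (0::complex) (fps_conv_radius H)"
  have H: "?h has_fps_expansion H" using conv by (rule eval_fps_has_fps_expansion)
  have holo: "?h holomorphic_on ?S" by (intro holomorphic_on_eval_fps) auto
  have S: "0 \<in> ?S" "open ?S" using conv by (auto simp: zero_ereal_def)
  have h0: "?h 0 = 0" by (simp add: eval_fps_at_0 H_def)
  have h1: "deriv ?h 0 = 1" using fps_nth_fps_expansion[OF H, of 1] by (simp add: H_def)
  \<comment> \<open>Derivative 1 at the origin makes the sum injective on a small ball, which serves
    as the set \<open>S\<close>; continuity of \<open>f\<close> keeps \<open>f z\<close> in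
    it.\<close>
  obtain r where r: "r > 0" "ball 0 r \<subseteq> ?S" "inj_on ?h (ball 0 r)"
    by (rule has_complex_derivative_locally_injective[OF holo S]) (use h1 in auto)
  have "(?h \<circ> f) has_fps_expansion fps_compose H F"
    by (intro has_fps_expansion_compose H f)
  also have "fps_compose H F = fps_const l * H"
    unfolding H_def using linearization_coeff_solves[of F] f l by auto
  finally have 1: "(?h \<circ> f) has_fps_expansion fps_const l * H" .
  have 2: "(\<lambda>z. l * ?h z) has_fps_expansion fps_const l * H"
    by (intro fps_expansion_intros H)
  have f0: "f 0 = 0" using f has_fps_expansion_imp_0_eq_fps_nth_0 by metis
  have "isCont f 0" using has_fps_expansion_imp_continuous[OF f(1), of UNIV] by simp
  then have "(f \<longlongrightarrow> f 0) (nhds 0)"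
    by (simp add: isCont_def tendsto_at_iff_tendsto_nhds)
  then have "eventually (\<lambda>z. f z \<in> ball 0 r) (nhds 0)"
    by (rule topological_tendstoD) (use r(1) f0 in auto)
  moreover have "eventually (\<lambda>z::complex. z \<in> ball 0 r) (nhds 0)"
    using r(1) by (intro eventually_nhds_in_open) auto
  moreover have "eventually (\<lambda>z. (?h \<circ> f) z = l * ?h z) (nhds 0)"
  proof -
    from 1 2 have "eventually (\<lambda>z. eval_fps (fps_const l * H) z = (?h \<circ> f) z) (nhds 0)"
      "eventually (\<lambda>z. eval_fps (fps_const l * H) z = l * ?h z) (nhds 0)"
      by (simp_all add: has_fps_expansion_def)
    then show ?thesis by eventually_elim simp
  qed
  ultimately have "\<forall>\<^sub>F z in nhds 0. z \<in> ball 0 r \<and> f z \<in> ball 0 r \<and> ?h (f z) = l * ?h z"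
    by eventually_elim simp
  then show "linearizable_at_0 l f"
    unfolding linearizable_at_0_def using r h0 h1 holomorphic_on_subset[OF holo r(2)]
    by (intro exI[of _ ?h] exI[of _ "ball 0 r"]) auto
qed

section \<open>Polynomial dependence on one parameter\<close>

text \<open>\<open>N\<close> is only an upper bound for the degree, so cancellation in sums does no
  harm.\<close>

definition poly_function :: "nat \<Rightarrow> (complex \<Rightarrow> complex) \<Rightarrow> bool" where
  "poly_function N g \<longleftrightarrow> (\<exists>p. degree p \<le> N \<and> g = poly p)"

lemma poly_function_const [intro]: "poly_function N (\<lambda>_. c)"
  unfolding poly_function_def by (intro exI[of _ "[:c:]"]) auto

lemma poly_function_linear: "poly_function 1 (\<lambda>w. a + w * b)"
  unfolding poly_function_def by (intro exI[of _ "[:a, b:]"]) auto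

lemma poly_function_mono: "poly_function N g \<Longrightarrow> N \<le> M \<Longrightarrow> poly_function M g"
  unfolding poly_function_def using order_trans by blast

lemma poly_function_add:
  assumes "poly_function N g" "poly_function N h"
  shows "poly_function N (\<lambda>w. g w + h w)"
proof -
  from assms obtain p q where "degree p \<le> N" "g = poly p" "degree q \<le> N" "h = poly q"
    unfolding poly_function_def by blast
  then show ?thesis
    unfolding poly_function_def by (intro exI[of _ "p + q"]) (auto intro: degree_add_le)
qed

lemma poly_function_mult:
  assumes "poly_function N g" "poly_function M h"
  shows "poly_function (N + M) (\<lambda>w. g w * h w)"
proof -
  from assms obtain p q where "degree p \<le> N" "g = poly p" "degree q \<le> M" "h = poly q"
    unfolding poly_function_def by blast
  then show ?thesis
    unfolding poly_function_def
    by (intro exI[of _ "p * q"]) (auto intro: order_trans[OF degree_mult_le])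
qed

lemma poly_function_sum:
  "(\<And>i. i \<in> I \<Longrightarrow> poly_function N (g i)) \<Longrightarrow> poly_function N (\<lambda>w. \<Sum>i\<in>I. g i w)"
  by (induction I rule: infinite_finite_induct) (auto intro: poly_function_add)

lemma poly_function_prod:
  "(\<And>i. i \<in> I \<Longrightarrow> poly_function (N i) (g i)) \<Longrightarrow> poly_function (\<Sum>i\<in>I. N i) (\<lambda>w. \<Prod>i\<in>I. g i w)"
  by (induction I rule: infinite_finite_induct) (auto intro: poly_function_mult)

lemma poly_function_power:
  assumes "poly_function N g"
  shows "poly_function (N * k) (\<lambda>w. g w ^ k)"
  using poly_function_prod[of "{..<k}" "\<lambda>_. N" "\<lambda>_. g"] assms by (simp add: mult.commute)

text \<open>
  Powers of \<open>F\<close> are handled through \<open>F = X G\<close>, because the bound \<open>d k\<close> on the degree of the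
  \<open>k\<close>-th coefficient is stable under products.
\<close>

lemma poly_function_fps_power:
  fixes F :: "complex \<Rightarrow> complex fps"
  assumes F0: "\<And>w. fps_nth (F w) 0 = 0"
    and F: "\<And>k. poly_function (d * k) (\<lambda>w. fps_nth (F w) (Suc k))"
  shows "poly_function (d * (n - j)) (\<lambda>w. fps_nth (F w ^ j) n)"
proof -
  define G where "G w = fps_shift 1 (F w)" for w
  have FG: "F w = fps_X * G w" for w
    by (rule fps_ext) (auto simp: G_def F0)
  have G: "poly_function (d * k) (\<lambda>w. fps_nth (G w ^ j) k)" for k
  proof (induction j arbitrary: k)
    case 0
    show ?case by (auto simp: fps_one_nth)
  next
    case (Suc j)
    have "poly_function (d * k) (\<lambda>w. fps_nth (G w) i * fps_nth (G w ^ j) (k - i))" if "i \<in> {0..k}" for i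
    proof -
      have "poly_function (d * i + d * (k - i)) (\<lambda>w. fps_nth (G w) i * fps_nth (G w ^ j) (k - i))"
        using F by (intro poly_function_mult Suc) (simp add: G_def)
      also have "d * i + d * (k - i) = d * k"
        using that by (simp add: distrib_left[symmetric])
      finally show ?thesis .
    qed
    then show ?case unfolding power_Suc fps_mult_nth by (rule poly_function_sum)
  qed
  show ?thesis
    \<comment> \<open>For n < j the coefficient is 0, so the truncated difference
      \<open>n - j\<close> is harmless.\<close>
    using G[of "n - j"]
    by (cases "n < j") (auto simp: FG power_mult_distrib fps_X_power_mult_nth)
qed

text \<open>In the recursion the j-th summand has degree at most d j + d (n - j) = d n, and the
  divisor is constant because the linear coefficient is independent of \<open>w\<close>.\<close>

lemma poly_function_linearization_coeff:
  fixes F :: "complex \<Rightarrow> complex fps"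
  assumes F0: "\<And>w. fps_nth (F w) 0 = 0" and F1: "\<And>w. fps_nth (F w) 1 = l"
    and F: "\<And>k. poly_function (d * k) (\<lambda>w. fps_nth (F w) (Suc k))"
  shows "poly_function (d * n) (\<lambda>w. linearization_coeff (F w) n)"
proof (induction n rule: less_induct)
  case (less n)
  consider "n = 0" | "n = 1" | "n \<ge> 2" by linarith
  then show ?case
  proof cases
    case 3
    have "poly_function (d * n) (\<lambda>w. linearization_coeff (F w) j * fps_nth (F w ^ j) n)"
      if "j \<in> {..<n}" for j
    proof -
      have "poly_function (d * j + d * (n - j)) (\<lambda>w. linearization_coeff (F w) j * fps_nth (F w ^ j) n)"
        using that by (intro poly_function_mult less poly_function_fps_power F0 F) auto
      also have "d * j + d * (n - j) = d * n"
        using that by (simp add: distrib_left[symmetric])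
      finally show ?thesis .
    qed
    then have "poly_function (d * n)
        (\<lambda>w. \<Sum>j<n. linearization_coeff (F w) j * fps_nth (F w ^ j) n)"
      by (rule poly_function_sum)
    then have "poly_function (d * n + 0)
        (\<lambda>w. (\<Sum>j<n. linearization_coeff (F w) j * fps_nth (F w ^ j) n) * inverse (l - l ^ n))"
      by (intro poly_function_mult) auto
    moreover have "linearization_coeff (F w) n =
        (\<Sum>j<n. linearization_coeff (F w) j * fps_nth (F w ^ j) n) * inverse (l - l ^ n)" for w
      using 3 by (subst linearization_coeff.simps) (simp add: F1[simplified] divide_inverse)
    ultimately show ?thesis by simp
  qed auto
qed

section \<open>Sets saturated along complex lines\<close>

text \<open>This dichotomy on lines passes to \<open>Gamma_step\<close> and to unitary images, which
  allows induction on the dimension.\<close>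

definition line_saturated :: "nat \<Rightarrow> complex Matrix.vec set \<Rightarrow> bool" where
  "line_saturated n E \<longleftrightarrow> E \<subseteq> carrier_vec n \<and>
     (\<forall>a\<in>carrier_vec n. \<forall>b\<in>carrier_vec n.
        log_capacity {w. a + w \<cdot>\<^sub>v b \<in> E} > 0 \<longrightarrow> (\<forall>w. a + w \<cdot>\<^sub>v b \<in> E))"

lemma line_saturatedD:
  assumes "line_saturated n E" "a \<in> carrier_vec n" "b \<in> carrier_vec n"
    and "log_capacity {w. a + w \<cdot>\<^sub>v b \<in> E} > 0"
  shows "a + w \<cdot>\<^sub>v b \<in> E"
  using assms unfolding line_saturated_def by blast

lemma carrier_vec_SucE:
  assumes "v \<in> carrier_vec (Suc n)"
  obtains z w where "z \<in> carrier_vec n" "v = z @\<^sub>v vec_of_list [w]"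
proof
  show "Matrix.vec n (\<lambda>i. vec_index v i) \<in> carrier_vec n" by simp
  show "v = Matrix.vec n (\<lambda>i. vec_index v i) @\<^sub>v vec_of_list [vec_index v n]"
    using assms by (intro eq_vecI) (auto simp: less_Suc_eq)
qed

lemma vec_of_list_singleton_carrier: "vec_of_list [w] \<in> carrier_vec (Suc 0)"
  by (rule carrier_vecI) simp

lemma line_last_coordinate:
  fixes z :: "complex Matrix.vec"
  assumes "z \<in> carrier_vec n"
  shows "(z @\<^sub>v vec_of_list [0]) + w \<cdot>\<^sub>v (0\<^sub>v n @\<^sub>v vec_of_list [1]) = z @\<^sub>v vec_of_list [w]"
  using assms by (intro eq_vecI) (auto simp: less_Suc_eq)

lemma line_first_coordinates:
  fixes a b :: "complex Matrix.vec"
  assumes "a \<in> carrier_vec n" "b \<in> carrier_vec n"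
  shows "(a @\<^sub>v vec_of_list [v]) + w \<cdot>\<^sub>v (b @\<^sub>v vec_of_list [0]) = (a + w \<cdot>\<^sub>v b) @\<^sub>v vec_of_list [v]"
  using assms by (intro eq_vecI) (auto simp: less_Suc_eq)

text \<open>A fibre is a line in the direction of the last coordinate, so a nonpolar fibre is full.
  For saturation, a line in the base is lifted to each fixed value of the last coordinate.\<close>

lemma Gamma_step_line_saturated:
  assumes "line_saturated (Suc n) E"
  shows "z \<in> Gamma_step n E \<Longrightarrow> z @\<^sub>v vec_of_list [w] \<in> E"
    and "line_saturated n (Gamma_step n E)"
proof -
  have carrier: "z @\<^sub>v vec_of_list [w] \<in> carrier_vec (Suc n)" if "z \<in> carrier_vec n" for z w
    using append_carrier_vec[OF that vec_of_list_singleton_carrier[of w]] by simp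
  show fibre: "z @\<^sub>v vec_of_list [w] \<in> E" if "z \<in> Gamma_step n E" for z w
  proof -
    from that have z: "z \<in> carrier_vec n" "log_capacity {w. z @\<^sub>v vec_of_list [w] \<in> E} > 0"
      by (auto simp: Gamma_step_def)
    show ?thesis
      using line_saturatedD[OF assms carrier[OF z(1), of 0] carrier[OF zero_carrier_vec, of 1]] z(2)
      unfolding line_last_coordinate[OF z(1)] by blast
  qed
  show "line_saturated n (Gamma_step n E)"
    unfolding line_saturated_def
  proof (intro conjI ballI impI allI)
    show "Gamma_step n E \<subseteq> carrier_vec n" by (auto simp: Gamma_step_def)
  next
    fix a b :: "complex Matrix.vec" and w
    assume ab: "a \<in> carrier_vec n" "b \<in> carrier_vec n"
      and cap: "log_capacity {w. a + w \<cdot>\<^sub>v b \<in> Gamma_step n E} > 0"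
    \<comment> \<open>With \<open>v\<close> frozen, the lifted line meets \<open>E\<close> at least
      over the given nonpolar set of \<open>w\<close>, hence lies in \<open>E\<close>.\<close>
    have all: "(a + w \<cdot>\<^sub>v b) @\<^sub>v vec_of_list [v] \<in> E" for v w
    proof -
      have "{w. a + w \<cdot>\<^sub>v b \<in> Gamma_step n E} \<subseteq> {w. (a + w \<cdot>\<^sub>v b) @\<^sub>v vec_of_list [v] \<in> E}"
        using fibre by blast
      from log_capacity_mono[OF this] cap
      have "log_capacity {w. (a + w \<cdot>\<^sub>v b) @\<^sub>v vec_of_list [v] \<in> E} > 0"
        by (rule less_le_trans[rotated])
      then show ?thesis
        using line_saturatedD[OF assms carrier[OF ab(1), of v] carrier[OF ab(2), of 0]]
        unfolding line_first_coordinates[OF ab] by blast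
    qed
    obtain w0 where "a + w0 \<cdot>\<^sub>v b \<in> Gamma_step n E"
      using log_capacity_pos_nonempty[OF cap] by blast
    \<comment> \<open>That the plane is nonpolar is read off the fibre over this one point, which is
      the whole plane.\<close>
    then have "log_capacity (UNIV :: complex set) > 0"
      using all by (simp add: Gamma_step_def)
    then show "a + w \<cdot>\<^sub>v b \<in> Gamma_step n E"
      using ab all by (simp add: Gamma_step_def)
  qed
qed

lemma line_saturated_Gamma_proj:
  assumes "line_saturated (Suc n) E" "log_capacity (Gamma_proj (Suc n) E) > 0"
  shows "E = carrier_vec (Suc n)"
  using assms
proof (induction n arbitrary: E)
  case 0
  \<comment> \<open>In dimension 1 the whole space is a single line.\<close>
  have line: "0\<^sub>v (Suc 0) + w \<cdot>\<^sub>v vec_of_list [1] = vec_of_list [w]" for w :: complex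
    by (intro eq_vecI) auto
  have "vec_of_list [w] \<in> E" for w
    using line_saturatedD[OF 0(1) zero_carrier_vec vec_of_list_singleton_carrier[of 1], of w] 0(2)
    unfolding line by simp
  moreover have "E \<subseteq> carrier_vec (Suc 0)" using 0(1) by (simp add: line_saturated_def)
  moreover have "v = vec_of_list [vec_index v 0]" if "v \<in> carrier_vec (Suc 0)" for v :: "complex Matrix.vec"
    using that by (intro eq_vecI) auto
  ultimately show ?case by (metis subsetI subset_antisym)
next
  case (Suc n)
  have "Gamma_step (Suc n) E = carrier_vec (Suc n)"
    using Suc.prems Gamma_step_line_saturated(2)[OF Suc.prems(1)] by (intro Suc.IH) auto
  then have "z @\<^sub>v vec_of_list [w] \<in> E" if "z \<in> carrier_vec (Suc n)" for z w
    using Gamma_step_line_saturated(1)[OF Suc.prems(1)] that by blast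
  then have "carrier_vec (Suc (Suc n)) \<subseteq> E"
    by (metis carrier_vec_SucE subsetI)
  then show ?case using Suc.prems(1) by (auto simp: line_saturated_def)
qed

text \<open>An invertible linear map sends lines to lines with the same parameter \<open>w\<close>,
  so the traces are unchanged.\<close>

lemma line_saturated_unitary:
  assumes E: "line_saturated n E" and U: "U \<in> unitary_mats n"
  shows "line_saturated n ((*\<^sub>v) U ` E)"
    and "(*\<^sub>v) U ` E = carrier_vec n \<Longrightarrow> E = carrier_vec n"
proof -
  define V where "V = mat_adjoint U"
  have UV: "U \<in> carrier_mat n n" "V \<in> carrier_mat n n" "V * U = 1\<^sub>m n"
    using U by (auto simp: unitary_mats_def V_def mat_adjoint_def)
  then have "U * V = 1\<^sub>m n"
    using mat_mult_left_right_inverse by blast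
  then have UV_id: "U *\<^sub>v (V *\<^sub>v v) = v" "V *\<^sub>v (U *\<^sub>v v) = v" if "v \<in> carrier_vec n" for v
    using that UV by (metis assoc_mult_mat_vec one_mult_mat_vec)+
  have sub: "E \<subseteq> carrier_vec n" using E by (simp add: line_saturated_def)
  have mem: "v \<in> (*\<^sub>v) U ` E \<longleftrightarrow> V *\<^sub>v v \<in> E" if "v \<in> carrier_vec n" for v
  proof
    assume "v \<in> (*\<^sub>v) U ` E"
    then show "V *\<^sub>v v \<in> E" using sub UV_id(2) by force
  next
    assume "V *\<^sub>v v \<in> E"
    then show "v \<in> (*\<^sub>v) U ` E" using UV_id(1)[OF that] by (metis image_eqI)
  qed
  have Vline: "V *\<^sub>v (a + w \<cdot>\<^sub>v b) = V *\<^sub>v a + w \<cdot>\<^sub>v (V *\<^sub>v b)"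
    if "a \<in> carrier_vec n" "b \<in> carrier_vec n" for a b w
    using that UV by (simp add: mult_add_distrib_mat_vec mult_mat_vec)
  show "line_saturated n ((*\<^sub>v) U ` E)"
    unfolding line_saturated_def
  proof (intro conjI ballI impI allI)
    show "(*\<^sub>v) U ` E \<subseteq> carrier_vec n" using sub UV(1) by auto
  next
    fix a b :: "complex Matrix.vec" and w
    assume ab: "a \<in> carrier_vec n" "b \<in> carrier_vec n"
      and cap: "log_capacity {w. a + w \<cdot>\<^sub>v b \<in> (*\<^sub>v) U ` E} > 0"
    have line: "a + w \<cdot>\<^sub>v b \<in> (*\<^sub>v) U ` E \<longleftrightarrow> V *\<^sub>v a + w \<cdot>\<^sub>v (V *\<^sub>v b) \<in> E" for w
      using ab by (simp add: mem Vline)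
    show "a + w \<cdot>\<^sub>v b \<in> (*\<^sub>v) U ` E"
      using line_saturatedD[OF E, of "V *\<^sub>v a" "V *\<^sub>v b" w] cap ab UV(2) unfolding line by simp
  qed
  show "E = carrier_vec n" if "(*\<^sub>v) U ` E = carrier_vec n"
  proof
    show "carrier_vec n \<subseteq> E"
    proof
      fix v :: "complex Matrix.vec" assume v: "v \<in> carrier_vec n"
      then have "U *\<^sub>v v \<in> (*\<^sub>v) U ` E" using UV(1) by (simp add: that)
      then show "v \<in> E" using v UV(1) by (simp add: mem UV_id)
    qed
  qed (rule sub)
qed

theorem line_saturated_Gamma_capacity:
  assumes "n \<ge> 1" "line_saturated n E" "Gamma_capacity n E \<noteq> 0"
  shows "E = carrier_vec n"
proof -
  obtain U where U: "U \<in> unitary_mats n" "log_capacity (Gamma_proj n ((*\<^sub>v) U ` E)) > 0"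
    using assms(3) unfolding Gamma_capacity_def
    by (auto simp: less_SUP_iff simp flip: zero_less_iff_neq_zero)
  obtain n' where "n = Suc n'" using assms(1) by (cases n) auto
  then show ?thesis
    using line_saturated_Gamma_proj line_saturated_unitary[OF assms(2) U(1)] U(2) by blast
qed

section \<open>The family restricted to a complex line, and the conclusion\<close>

lemma irrational_rotation_power_neq:
  assumes "\<alpha> \<notin> \<rat>" "l = exp (2 * of_real pi * \<i> * of_real \<alpha>)" "n \<ge> 2"
  shows "l ^ n \<noteq> l"
proof
  assume "l ^ n = l"
  moreover have "l ^ n = l * l ^ (n - 1)" using assms(3) by (cases n) auto
  ultimately have "l ^ (n - 1) = 1" by (auto simp: assms(2))
  then have "exp (of_nat (n - 1) * (2 * of_real pi * \<i> * of_real \<alpha>)) = 1"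
    by (simp add: assms(2) exp_of_nat_mult)
  then obtain k :: int where "real (n - 1) * (2 * pi * \<alpha>) = of_int (2 * k) * pi"
    unfolding exp_eq_1 by auto
  then have "real (n - 1) * \<alpha> = of_int k" by (simp add: field_simps)
  then have "\<alpha> = of_int k / real (n - 1)" using assms(3) by (simp add: field_simps)
  then have "\<alpha> \<in> \<rat>" by simp
  with assms(1) show False by contradiction
qed

lemma has_fps_expansion_bigo_square:
  assumes "f holomorphic_on UNIV" "f \<in> O[nhds 0](\<lambda>z. z ^ 2)"
  obtains G where "f has_fps_expansion G" "fps_nth G 0 = 0" "fps_nth G 1 = 0"
proof -
  define G where "G = fps_expansion f 0"
  have G: "f has_fps_expansion G"
    unfolding G_def using assms(1) by (intro has_fps_expansion_fps_expansion) auto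
  obtain c where c: "\<forall>\<^sub>F z in nhds 0. cmod (f z) \<le> c * cmod (z ^ 2)"
    using assms(2) by (auto elim!: landau_o.bigE)
  \<comment> \<open>The filter \<open>nhds 0\<close> includes the origin itself, so the bound can be
    evaluated at z = 0.\<close>
  then have f0: "f 0 = 0" by (auto dest: eventually_nhds_x_imp_x)
  have "(\<lambda>z. f z / z) \<midarrow>0\<rightarrow> 0"
  proof (rule Lim_null_comparison)
    have "\<forall>\<^sub>F z in at 0. cmod (f z) \<le> c * cmod (z ^ 2)"
      using c by (simp add: eventually_nhds_conv_at)
    moreover have "\<forall>\<^sub>F z :: complex in at 0. z \<noteq> 0" by (simp add: eventually_neq_at_within)
    ultimately show "\<forall>\<^sub>F z in at 0. norm (f z / z) \<le> c * cmod z"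
      by eventually_elim (simp add: norm_divide norm_mult power2_eq_square field_simps)
    show "((\<lambda>z. c * cmod z) \<longlongrightarrow> 0) (at 0)" by (auto intro!: tendsto_eq_intros)
  qed
  then have "(f has_field_derivative 0) (at 0)"
    by (simp add: has_field_derivative_iff f0)
  then have "deriv f 0 = 0" by (rule DERIV_imp_deriv)
  then have "fps_nth G 1 = 0" "fps_nth G 0 = 0"
    using fps_nth_fps_expansion[OF G] f0 by simp_all
  with G show thesis using that by blast
qed

text \<open>On a line each coordinate is affine in \<open>w\<close>, so a monomial has degree at
  most its total exponent.\<close>

lemma poly_function_multi_power:
  assumes "a \<in> carrier_vec m" "b \<in> carrier_vec m" "i \<in> multi_indices m d"
  shows "poly_function d (\<lambda>w. multi_power (a + w \<cdot>\<^sub>v b) i)"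
proof -
  from assms(3) have i: "dim_vec i = m" "(\<Sum>k<m. vec_index i k) \<le> d"
    by (auto simp: multi_indices_def)
  have "poly_function (\<Sum>k<m. vec_index i k) (\<lambda>w. \<Prod>k<m. (vec_index a k + w * vec_index b k) ^ vec_index i k)"
    using poly_function_power[OF poly_function_linear] by (intro poly_function_prod) simp
  also have "(\<lambda>w. \<Prod>k<m. (vec_index a k + w * vec_index b k) ^ vec_index i k) = (\<lambda>w. multi_power (a + w \<cdot>\<^sub>v b) i)"
    using assms(1,2) i(1) by (auto simp: multi_power_def fun_eq_iff intro!: prod.cong)
  finally show ?thesis using i(2) by (rule poly_function_mono)
qed

text \<open>Along a line the formal coefficients are polynomials in \<open>w\<close> of degree at
  most d n, and linearizability is their exponential growth, so the growth dichotomy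
  applies.\<close>

lemma linearizable_line_saturated:
  assumes l: "\<And>n. n \<ge> 2 \<Longrightarrow> l ^ n \<noteq> l"
    and f: "\<And>i. i \<in> multi_indices m d \<Longrightarrow> f i holomorphic_on UNIV"
      "\<And>i. i \<in> multi_indices m d \<Longrightarrow> f i \<in> O[nhds 0](\<lambda>z. z ^ 2)"
  shows "line_saturated m {t \<in> carrier_vec m. linearizable_at_0 l (poly_family m d l f t)}"
    (is "line_saturated m ?E")
  unfolding line_saturated_def
proof (intro conjI ballI impI allI)
  fix a b :: "complex Matrix.vec" and w0
  assume ab: "a \<in> carrier_vec m" "b \<in> carrier_vec m"
    and cap: "log_capacity {w. a + w \<cdot>\<^sub>v b \<in> ?E} > 0"
  have "\<forall>i\<in>multi_indices m d. \<exists>G. f i has_fps_expansion G \<and> fps_nth G 0 = 0 \<and> fps_nth G 1 = 0"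
    using has_fps_expansion_bigo_square f by metis
  then obtain G where G: "\<And>i. i \<in> multi_indices m d \<Longrightarrow> f i has_fps_expansion G i"
    "\<And>i. i \<in> multi_indices m d \<Longrightarrow> fps_nth (G i) 0 = 0"
    "\<And>i. i \<in> multi_indices m d \<Longrightarrow> fps_nth (G i) 1 = 0" by metis
  define F where "F w = fps_const l * fps_X +
    (\<Sum>i\<in>multi_indices m d. fps_const (multi_power (a + w \<cdot>\<^sub>v b) i) * G i)" for w
  have expansion: "poly_family m d l f (a + w \<cdot>\<^sub>v b) has_fps_expansion F w" for w
    unfolding F_def poly_family_def by (intro fps_expansion_intros G)
  have nth: "fps_nth (F w) k = (if k = 1 then l else 0) +
      (\<Sum>i\<in>multi_indices m d. multi_power (a + w \<cdot>\<^sub>v b) i * fps_nth (G i) k)" for w k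
    by (simp add: F_def fps_sum_nth fps_X_def)
  have F0: "fps_nth (F w) 0 = 0" and F1: "fps_nth (F w) 1 = l" for w
    unfolding nth using G by simp_all
  \<comment> \<open>For k = 0 degree 0 is required: the linear coefficient is the constant
    \<open>l\<close>, as every \<open>f i\<close> vanishes to second order. For k \<ge> 1 the degree
    is at most d \<le> d k.\<close>
  have "poly_function (d * k) (\<lambda>w. fps_nth (F w) (Suc k))" for k
  proof (cases "k = 0")
    case True
    then show ?thesis using F1 by auto
  next
    case False
    then have "poly_function (d + 0) (\<lambda>w. multi_power (a + w \<cdot>\<^sub>v b) i * fps_nth (G i) (Suc k))"
      if "i \<in> multi_indices m d" for i
      using that ab by (intro poly_function_mult poly_function_multi_power) auto
    then have "poly_function d (\<lambda>w. fps_nth (F w) (Suc k))"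
      unfolding nth by (intro poly_function_add poly_function_sum) auto
    then show ?thesis by (rule poly_function_mono) (use False in auto)
  qed
  then have "poly_function (d * n) (\<lambda>w. linearization_coeff (F w) n)" for n
    by (rule poly_function_linearization_coeff[OF F0 F1])
  then obtain p where p: "\<And>n. degree (p n) \<le> d * n" "\<And>n. (\<lambda>w. linearization_coeff (F w) n) = poly (p n)"
    unfolding poly_function_def by metis
  have iff: "a + w \<cdot>\<^sub>v b \<in> ?E \<longleftrightarrow> (\<exists>k::nat. \<forall>n. cmod (poly (p n) w) \<le> real k ^ n)" for w
    using linearizable_at_0_iff[OF expansion F0 F1 l] ab by (simp add: p(2)[symmetric])
  show "a + w0 \<cdot>\<^sub>v b \<in> ?E"
    using exponential_growth_dichotomy[OF p(1)] cap unfolding iff by blast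
qed auto

theorem corollary1:
  fixes m d :: nat
    and \<alpha> :: real
    and l :: complex
    and f :: "nat Matrix.vec \<Rightarrow> complex \<Rightarrow> complex"
  assumes "m \<ge> 1"
    and "\<alpha> \<notin> \<rat>"
    and "l = exp (2 * of_real pi * \<i> * of_real \<alpha>)"
    and "\<And>i. i \<in> multi_indices m d \<Longrightarrow> f i holomorphic_on UNIV"
    and "\<And>i. i \<in> multi_indices m d \<Longrightarrow> f i \<in> O[nhds 0](\<lambda>z. z ^ 2)"
  shows "(\<forall>t\<in>carrier_vec m. linearizable_at_0 l (poly_family m d l f t)) \<or>
         (\<exists>E\<subseteq>carrier_vec m. Gamma_capacity m E = 0 \<and>
            (\<forall>t\<in>carrier_vec m - E. \<not> linearizable_at_0 l (poly_family m d l f t)))"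
proof -
  \<comment> \<open>The exceptional set is the full set of linearizable parameters.\<close>
  let ?E = "{t \<in> carrier_vec m. linearizable_at_0 l (poly_family m d l f t)}"
  have "line_saturated m ?E"
    using irrational_rotation_power_neq[OF assms(2,3)] assms(4,5) by (rule linearizable_line_saturated)
  then have "?E = carrier_vec m \<or> Gamma_capacity m ?E = 0"
    using line_saturated_Gamma_capacity[OF assms(1)] by blast
  then show ?thesis
  proof
    assume "Gamma_capacity m ?E = 0"
    then show ?thesis by (intro disjI2 exI[of _ ?E]) auto
  qed blast
qed

end
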